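(* Let $(\mathcal{C},F)$ be a generalized network code. For any $x_1,x_2\in\mathcal{C}$ with $x_1\ne x_2$, $$D_1(x_1,x_2)\ \ge\ \left\lfloor \frac{D_0(x_1,x_2)}{2}\right\rfloor+1 .$$
   Context: A generalized network channel consists of a set $\mathcal{C}$ of codewords, a set $\mathcal{E}$ of errors with a distinguished element $0$ (the zero error), an output set $\mathcal{Y}$, a weight $w:\mathcal{E}\to\mathbb{Z}_{\ge 0}$ with $w(z)=0$ if and only if $z=0$, and a transfer function $F:\mathcal{C}\times\mathcal{E}\to\mathcal{Y}$ such that $F(x,0)\ne F(x',0)$ whenever $x\neq x'$ in $\mathcal{C}$. The sets are otherwise arbitrary. The pair $(\mathcal{C},F)$ is called a generalized network code; $|\mathcal{C}|\ge 2$ is assumed. For $x\in\mathcal{C}$ and an integer $c\ge 0$, the decoding ball is $\Phi(x,c)=\{F(x,z): z\in\mathcal{E},\ w(z)\le c\}$. For $x_1,x_2\in\mathcal{C}$ (all $c$'s are nonnegative integers, and a minimum over the empty set is $+\infty$, with $\lfloor +\infty/2\rfloor=+\infty$): $D_0(x_1,x_2)=\min\{c_1+c_2 : |c_1-c_2|\le 1,\ \Phi(x_1,c_1)\cap\Phi(x_2,c_2)\ne\emptyset\}$; $D_1(x_1,x_2)=\min\{c : \Phi(x_1,0)\cap\Phi(x_2,c)\neq\emptyset\}$. *)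

theory Defs
  imports "HOL-Library.Extended_Nat"
begin

text \<open>
  Codewords \<open>C\<close>, errors \<open>E\<close> with zero error \<open>e0\<close>, outputs \<open>Y\<close>, weight \<open>w\<close>, transfer function
  \<open>F\<close> (curried). The values of \<open>w\<close> outside \<open>E\<close> and of \<open>F\<close> outside \<open>C\<close> and \<open>E\<close> are irrelevant.
\<close>

locale generalized_network_channel =
  fixes C :: "'c set" and E :: "'e set" and e0 :: 'e and Y :: "'y set"
    and w :: "'e \<Rightarrow> nat" and F :: "'c \<Rightarrow> 'e \<Rightarrow> 'y"
  assumes zero_error: "e0 \<in> E"
    and weight_eq_0_iff: "\<And>z. z \<in> E \<Longrightarrow> w z = 0 \<longleftrightarrow> z = e0"
    and transfer_in: "\<And>x z. x \<in> C \<Longrightarrow> z \<in> E \<Longrightarrow> F x z \<in> Y"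
    and transfer_zero_neq: "\<And>x x'. x \<in> C \<Longrightarrow> x' \<in> C \<Longrightarrow> x \<noteq> x' \<Longrightarrow> F x e0 \<noteq> F x' e0"

text \<open>
  The code \<open>(C, F)\<close> over the channel. Since \<open>C\<close> may be infinite, where \<^const>\<open>card\<close> is 0, having
  at least two codewords is stated by exhibiting two distinct ones.
\<close>

locale generalized_network_code = generalized_network_channel C E e0 Y w F
  for C :: "'c set" and E :: "'e set" and e0 :: 'e and Y :: "'y set"
    and w :: "'e \<Rightarrow> nat" and F :: "'c \<Rightarrow> 'e \<Rightarrow> 'y" +
  assumes two_codewords: "\<exists>x\<in>C. \<exists>x'\<in>C. x \<noteq> x'"

definition decoding_ball :: "'e set \<Rightarrow> ('e \<Rightarrow> nat) \<Rightarrow> ('c \<Rightarrow> 'e \<Rightarrow> 'y) \<Rightarrow> 'c \<Rightarrow> nat \<Rightarrow> 'y set" where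
  "decoding_ball E w F x c = {F x z | z. z \<in> E \<and> w z \<le> c}"

text \<open>
  On \<^typ>\<open>enat\<close> the infimum of a nonempty set is its minimum, and the infimum of the empty set
  is \<open>\<infinity>\<close>.
\<close>

definition D0 :: "'e set \<Rightarrow> ('e \<Rightarrow> nat) \<Rightarrow> ('c \<Rightarrow> 'e \<Rightarrow> 'y) \<Rightarrow> 'c \<Rightarrow> 'c \<Rightarrow> enat" where
  "D0 E w F x1 x2 = Inf {enat (c1 + c2) | c1 c2. \<bar>int c1 - int c2\<bar> \<le> 1 \<and>
     decoding_ball E w F x1 c1 \<inter> decoding_ball E w F x2 c2 \<noteq> {}}"

definition D1 :: "'e set \<Rightarrow> ('e \<Rightarrow> nat) \<Rightarrow> ('c \<Rightarrow> 'e \<Rightarrow> 'y) \<Rightarrow> 'c \<Rightarrow> 'c \<Rightarrow> enat" where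
  "D1 E w F x1 x2 = Inf {enat c | c.
     decoding_ball E w F x1 0 \<inter> decoding_ball E w F x2 c \<noteq> {}}"

definition floor_half :: "enat \<Rightarrow> enat" where
  "floor_half d = (case d of enat n \<Rightarrow> enat (n div 2) | \<infinity> \<Rightarrow> \<infinity>)"

end

(* If F x1 0 lies in the ball of radius c around x2, then c > 0 because distinct codewords have
   distinct error-free outputs. Enlarging the first ball to radius c - 1 gives a pair admissible
   for D0, whence D0 \<le> 2 c - 1. *)
theory Submission
  imports Defs
begin

lemma decoding_ball_mono:
  "c \<le> c' \<Longrightarrow> decoding_ball E w F x c \<subseteq> decoding_ball E w F x c'"
  unfolding decoding_ball_def using order_trans by blast

lemma (in generalized_network_channel) decoding_ball_0:
  "decoding_ball E w F x 0 = {F x e0}"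
  unfolding decoding_ball_def using zero_error weight_eq_0_iff by auto

lemma D0_le:
  assumes "\<bar>int c1 - int c2\<bar> \<le> 1"
    and "decoding_ball E w F x1 c1 \<inter> decoding_ball E w F x2 c2 \<noteq> {}"
  shows "D0 E w F x1 x2 \<le> enat (c1 + c2)"
  unfolding D0_def by (rule Inf_lower) (use assms in blast)

lemma floor_half_mono: "d \<le> d' \<Longrightarrow> floor_half d \<le> floor_half d'"
  unfolding floor_half_def by (cases d; cases d') (auto intro: div_le_mono)

theorem theorem4p8:
  fixes C :: "'c set" and E :: "'e set" and e0 :: 'e and Y :: "'y set"
    and w :: "'e \<Rightarrow> nat" and F :: "'c \<Rightarrow> 'e \<Rightarrow> 'y" and x1 x2 :: 'c
  assumes "generalized_network_code C E e0 Y w F"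
    and "x1 \<in> C" and "x2 \<in> C" and "x1 \<noteq> x2"
  shows "D1 E w F x1 x2 \<ge> floor_half (D0 E w F x1 x2) + 1"
proof -
  interpret generalized_network_code C E e0 Y w F by fact
  have "floor_half (D0 E w F x1 x2) + 1 \<le> enat c"
    if meet: "decoding_ball E w F x1 0 \<inter> decoding_ball E w F x2 c \<noteq> {}" for c
  proof -
    have "c \<noteq> 0"
      using meet transfer_zero_neq[OF assms(2-4)] by (cases c) (auto simp: decoding_ball_0)
    then obtain k where c: "c = Suc k"
      by (cases c) auto
    \<comment> \<open>The radii \<open>k\<close> and \<open>Suc k\<close> differ by exactly 1, the
      largest gap that \<open>D0\<close> admits, so the first ball need not grow all the way to
      radius \<open>c\<close>.\<close>
    have "decoding_ball E w F x1 k \<inter> decoding_ball E w F x2 (Suc k) \<noteq> {}"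
      using meet decoding_ball_mono[of 0 k E w F x1] unfolding c by blast
    then have "D0 E w F x1 x2 \<le> enat (k + Suc k)"
      by (intro D0_le) auto
    then have "floor_half (D0 E w F x1 x2) \<le> floor_half (enat (k + Suc k))"
      by (rule floor_half_mono)
    \<comment> \<open>The radii sum to the odd number \<open>2 * k + 1\<close>, and halving rounds
      it down to \<open>k = c - 1\<close>; this leaves room for the \<open>+ 1\<close> in the
      bound.\<close>
    also have "\<dots> = enat k"
      by (simp add: floor_half_def)
    finally have "floor_half (D0 E w F x1 x2) + 1 \<le> enat k + 1"
      by (rule add_right_mono)
    then show ?thesis
      by (simp add: c one_enat_def)
  qed
  \<comment> \<open>A lower bound on every admissible \<open>c\<close> suffices even when there is
    none: the infimum of the empty set is infinite.\<close>
  then show ?thesis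
    unfolding D1_def by (intro Inf_greatest) auto
qed

end
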